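(* For $x\ge0$, almost surely $Z_{\hat r}(t)\le Z_0(t)$ for all $t\ge0$. Consequently, for $k\ge1$, the post-update state of the AU algorithm satisfies $X_k\le Z_0(\tau_k)$ a.s.
   Context: Setting. $B$ is a standard Brownian motion on a filtered probability space $(\Omega,\mathcal F,\{\mathcal F_t\},\mathbb P)$; $\theta<0$, $\sigma>0$, $\gamma:=-2\theta/\sigma^2$; $\underline{\gamma}>0$ is a known constant with $\underline{\gamma}\le\gamma$. Assumption on $h:\mathbb R\to[0,\infty)$: (i) $h$ is continuous; $h$ is strictly increasing on $[0,\infty)$; $h$ is continuously differentiable on $(-\infty,0)$ with $h'(x)<0$ there; (ii) $\lim_{x\to-\infty}h(x)=+\infty$; (iii) there is a constant $0<b<\underline{\gamma}/2$ with $\limsup_{x\to+\infty}h(x)/e^{bx}<+\infty$. Reflected Brownian motion. For $s\ge 0$ and $\mathcal F_s$-measurable (possibly random) $r$ and $y\ge r$, $(Z_r^{s,y},Y_r^{s,y})$ is the unique continuous adapted pair on $[s,\infty)$ with $Z_r^{s,y}(t)=y+\theta(t-s)+\sigma(B(t)-B(s))+Y_r^{s,y}(t)\ge r$, $Y_r^{s,y}$ nondecreasing, $Y_r^{s,y}(s)=0$, $\int_s^t\mathbf 1_{\{Z_r^{s,y}(u)>r\}}\,dY_r^{s,y}(u)=0$ for $t\ge s$. $Z_0:=Z_0^{0,x}$ is the process reflected at level $0$ started at $x$. Cost. $C(u,r):=u\int_r^\infty h(z)e^{-u(z-r)}\,dz$ and $F(u,r):=C(u,r)-h(r)$. For each $u\ge\underline{\gamma}$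 the equation $F(u,r)=0$ has a unique solution $r\in\mathbb R$, which is negative; it is denoted $r(u)$. AU algorithm. Let $\tau_k:=2^k-1$, $\Delta\tau_k:=2^k$, $k\ge0$. Set $\hat r_0:=0$, $X_0:=x$. Recursively for $k\ge 0$: on $[\tau_k,\tau_{k+1})$ set $Z^{\mathrm{AU}}(t):=Z^{\tau_k,X_k}_{\hat r_k}(t)$; then $\hat\gamma_{k+1}:=\max\{(\frac1{\Delta\tau_k}\int_{\tau_k}^{\tau_{k+1}}(Z^{\mathrm{AU}}(s)-\hat r_k)\,ds)^{-1},\underline{\gamma}\}$, $\hat r_{k+1}:=r(\hat\gamma_{k+1})$, and the post-update state is $X_{k+1}:=\max\{Z^{\mathrm{AU}}(\tau_{k+1}-),\hat r_{k+1}\}$. Moving-boundary representation. $\hat r(t):=\sum_{k=0}^\infty\hat r_k\mathbf 1_{[\tau_k,\tau_{k+1})}(t)$, $Y_{\hat r}(t):=\sup_{0\le s\le t}(\hat r(s)-x-\theta s-\sigma B(s))^+$, and $Z_{\hat r}(t):=x+\theta t+\sigma B(t)+Y_{\hat r}(t)$. The process $Z_{\hat r}$ is the Skorokhod representation of the AU sample path $Z^{\mathrm{AU}}$; in particular $X_k=Z_{\hat r}(\tau_k)$. *)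

theory Defs
  imports "HOL-Probability.Probability"
begin

section \<open>Brownian motion on a filtered probability space\<close>

text \<open>
  Only times \<open>t \<ge> 0\<close> matter. The library locale \<open>filtration\<close> needs an index set that is a whole
  type, so the filtration is extended to negative times by its value at \<open>0\<close>.
\<close>

locale filtered_prob_space = prob_space M + filtration "space M" "\<lambda>t. F (max 0 t)"
  for M :: "'a measure" and F :: "real \<Rightarrow> 'a measure" +
  assumes subalgebra_F: "\<And>t. 0 \<le> t \<Longrightarrow> subalgebra M (F t)"

locale brownian_motion = filtered_prob_space M F
  for M :: "'a measure" and F :: "real \<Rightarrow> 'a measure" +
  fixes B :: "real \<Rightarrow> 'a \<Rightarrow> real"
  assumes adapted: "\<And>t. 0 \<le> t \<Longrightarrow> B t \<in> borel_measurable (F t)"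
    and start_0: "AE \<omega> in M. B 0 \<omega> = 0"
    and cont_paths: "AE \<omega> in M. continuous_on {0..} (\<lambda>t. B t \<omega>)"
    and normal_increments:
      "\<And>s t. 0 \<le> s \<Longrightarrow> s < t \<Longrightarrow>
        distributed M lborel (\<lambda>\<omega>. B t \<omega> - B s \<omega>) (normal_density 0 (sqrt (t - s)))"
    and indep_increments:
      "\<And>s t. 0 \<le> s \<Longrightarrow> s < t \<Longrightarrow>
        indep_set (sets (F s)) {(\<lambda>\<omega>. B t \<omega> - B s \<omega>) -` A \<inter> space M | A. A \<in> sets borel}"

section \<open>Reflected Brownian motion\<close>

text \<open>
  \<open>reflected_BM M F B \<theta> \<sigma> s r y Z Y\<close>: the pair \<open>(Z, Y)\<close> is a version of the Brownian motion with
  drift \<open>\<theta>\<close> and volatility \<open>\<sigma>\<close> reflected upwards at \<open>r\<close>, started from \<open>y\<close> at time \<open>s\<close>. It is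
  unique up to a null set, so the path properties are required almost surely. The integral with
  respect to \<open>dY\<close> is taken against the Lebesgue-Stieltjes measure of the path of \<open>Y\<close>, extended
  to the left of \<open>s\<close> by its value at \<open>s\<close>, so that \<open>s\<close> carries no mass.
\<close>

definition reflected_BM ::
    "'a measure \<Rightarrow> (real \<Rightarrow> 'a measure) \<Rightarrow> (real \<Rightarrow> 'a \<Rightarrow> real) \<Rightarrow> real \<Rightarrow> real \<Rightarrow>
     real \<Rightarrow> ('a \<Rightarrow> real) \<Rightarrow> ('a \<Rightarrow> real) \<Rightarrow> (real \<Rightarrow> 'a \<Rightarrow> real) \<Rightarrow> (real \<Rightarrow> 'a \<Rightarrow> real) \<Rightarrow> bool"
where
  "reflected_BM M F B \<theta> \<sigma> s r y Z Y \<longleftrightarrow>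
     0 \<le> s \<and> r \<in> borel_measurable (F s) \<and> y \<in> borel_measurable (F s) \<and>
     (\<forall>\<omega>\<in>space M. r \<omega> \<le> y \<omega>) \<and>
     (\<forall>t\<ge>s. Z t \<in> borel_measurable (F t) \<and> Y t \<in> borel_measurable (F t)) \<and>
     (AE \<omega> in M.
        continuous_on {s..} (\<lambda>t. Z t \<omega>) \<and> continuous_on {s..} (\<lambda>t. Y t \<omega>) \<and>
        (\<forall>t\<ge>s. Z t \<omega> = y \<omega> + \<theta> * (t - s) + \<sigma> * (B t \<omega> - B s \<omega>) + Y t \<omega> \<and> r \<omega> \<le> Z t \<omega>) \<and>
        mono_on {s..} (\<lambda>t. Y t \<omega>) \<and> Y s \<omega> = 0 \<and>
        (\<forall>t\<ge>s. (\<integral>\<^sup>+u\<in>{s..t}. indicator {v. r \<omega> < Z v \<omega>} u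
                    \<partial>interval_measure (\<lambda>u. Y (max s u) \<omega>)) = 0))"

section \<open>Holding cost and the optimal reflection level\<close>

definition cost_assumption :: "real \<Rightarrow> (real \<Rightarrow> real) \<Rightarrow> bool" where
  "cost_assumption \<gamma>low h \<longleftrightarrow>
     (\<forall>x. 0 \<le> h x) \<and>
     continuous_on UNIV h \<and> strict_mono_on {0..} h \<and>
     (\<forall>x<0. h differentiable (at x)) \<and> continuous_on {..<0} (deriv h) \<and> (\<forall>x<0. deriv h x < 0) \<and>
     filterlim h at_top at_bot \<and>
     (\<exists>b. 0 < b \<and> b < \<gamma>low / 2 \<and> Limsup at_top (\<lambda>x. ereal (h x / exp (b * x))) < \<infinity>)"

definition cost_C :: "(real \<Rightarrow> real) \<Rightarrow> real \<Rightarrow> real \<Rightarrow> real" where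
  "cost_C h u r = u * (LBINT z:{r..}. h z * exp (- u * (z - r)))"

definition cost_F :: "(real \<Rightarrow> real) \<Rightarrow> real \<Rightarrow> real \<Rightarrow> real" where
  "cost_F h u r = cost_C h u r - h r"

definition opt_level :: "(real \<Rightarrow> real) \<Rightarrow> real \<Rightarrow> real" where
  "opt_level h u = (THE r. cost_F h u r = 0)"

section \<open>The adaptive-update algorithm\<close>

definition tau :: "nat \<Rightarrow> real" where
  "tau k = 2 ^ k - 1"

definition Dtau :: "nat \<Rightarrow> real" where
  "Dtau k = 2 ^ k"

text \<open>
  \<open>ZAU\<close>, \<open>rhat\<close>, \<open>\<gamma>hat\<close> and \<open>X\<close> are a run of the recursion; \<open>\<gamma>hat 0\<close> is not used. A left limit
  at the end of each cycle exists almost surely because the path of \<open>Z\<close> is continuous.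
\<close>

definition AU_algorithm ::
    "'a measure \<Rightarrow> (real \<Rightarrow> 'a measure) \<Rightarrow> (real \<Rightarrow> 'a \<Rightarrow> real) \<Rightarrow> real \<Rightarrow> real \<Rightarrow>
     (real \<Rightarrow> real) \<Rightarrow> real \<Rightarrow> real \<Rightarrow>
     (real \<Rightarrow> 'a \<Rightarrow> real) \<Rightarrow> (nat \<Rightarrow> 'a \<Rightarrow> real) \<Rightarrow> (nat \<Rightarrow> 'a \<Rightarrow> real) \<Rightarrow> (nat \<Rightarrow> 'a \<Rightarrow> real) \<Rightarrow> bool"
where
  "AU_algorithm M F B \<theta> \<sigma> h \<gamma>low x ZAU rhat \<gamma>hat X \<longleftrightarrow>
     (\<forall>\<omega>\<in>space M. rhat 0 \<omega> = 0 \<and> X 0 \<omega> = x) \<and>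
     (\<forall>k. (\<exists>Z Y. reflected_BM M F B \<theta> \<sigma> (tau k) (rhat k) (X k) Z Y \<and>
                 (\<forall>\<omega>\<in>space M. \<forall>t\<in>{tau k..<tau (Suc k)}. ZAU t \<omega> = Z t \<omega>)) \<and>
          (\<forall>\<omega>\<in>space M.
             \<gamma>hat (Suc k) \<omega> =
               max (inverse (1 / Dtau k * (LBINT s:{tau k..<tau (Suc k)}. ZAU s \<omega> - rhat k \<omega>)))
                   \<gamma>low \<and>
             rhat (Suc k) \<omega> = opt_level h (\<gamma>hat (Suc k) \<omega>) \<and>
             X (Suc k) \<omega> = max (Lim (at_left (tau (Suc k))) (\<lambda>t. ZAU t \<omega>)) (rhat (Suc k) \<omega>)))"

section \<open>Moving-boundary representation\<close>

definition rhat_path :: "(nat \<Rightarrow> 'a \<Rightarrow> real) \<Rightarrow> real \<Rightarrow> 'a \<Rightarrow> real" where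
  "rhat_path rhat t \<omega> = (\<Sum>k. rhat k \<omega> * indicator {tau k..<tau (Suc k)} t)"

definition Y_moving ::
    "(real \<Rightarrow> 'a \<Rightarrow> real) \<Rightarrow> real \<Rightarrow> real \<Rightarrow> real \<Rightarrow> (nat \<Rightarrow> 'a \<Rightarrow> real) \<Rightarrow> real \<Rightarrow> 'a \<Rightarrow> real"
where
  "Y_moving B \<theta> \<sigma> x rhat t \<omega> =
     (SUP s\<in>{0..t}. max 0 (rhat_path rhat s \<omega> - x - \<theta> * s - \<sigma> * B s \<omega>))"

definition Z_moving ::
    "(real \<Rightarrow> 'a \<Rightarrow> real) \<Rightarrow> real \<Rightarrow> real \<Rightarrow> real \<Rightarrow> (nat \<Rightarrow> 'a \<Rightarrow> real) \<Rightarrow> real \<Rightarrow> 'a \<Rightarrow> real"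
where
  "Z_moving B \<theta> \<sigma> x rhat t \<omega> = x + \<theta> * t + \<sigma> * B t \<omega> + Y_moving B \<theta> \<sigma> x rhat t \<omega>"

end

theory Submission
  imports Defs
begin

text \<open>
  Everything rests on the sign of the reflection levels: every level chosen by the algorithm is at
  most \<open>0\<close>. A path that is pushed up at a lower barrier needs less pushing, so it stays
  below the path that is reflected at \<open>0\<close>.

  The sign is a fact about the cost (\<open>opt_level_neg\<close>). Write \<open>F(u,r)\<close> as \<open>exp (u * r)\<close>
  times \<open>D(r) = u * (\<integral> z\<ge>r. h z * exp (- u * z)) - exp (- u * r) * h r\<close>. For \<open>r \<ge> 0\<close> monotonicity of \<open>h\<close>
  makes \<open>D(r) > 0\<close>. For \<open>r < 0\<close> the derivative of \<open>D\<close> collapses to \<open>- exp (- u * r) * h' r > 0\<close>, and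
  \<open>D\<close> becomes negative far to the left because \<open>h\<close> tends to infinity there. Hence \<open>D\<close> has
  exactly one zero, and it is negative. Since the level is selected by a definite description, the
  existence and the uniqueness of the zero both matter: otherwise nothing is known about its sign.

  The bound on the moving-boundary process is then read off the explicit formula: the regulator
  \<open>Y\<^sub>0\<close> is nonnegative, nondecreasing and dominates \<open>- x - \<theta> * s - \<sigma> * B s\<close>, so it dominates the
  running supremum that defines the moving regulator.

  For the post-update states, the comparison is carried from one cycle to the next.
  Within a cycle both paths are driven by the same increments, and a path that strictly exceeded the
  path reflected at \<open>0\<close> would be off its own barrier and so would not be pushed since their last
  meeting (\<open>reflection_comparison\<close>). An update replaces the state by its maximum with a
  nonpositive level, which keeps it below the nonnegative \<open>Z\<^sub>0\<close>.
\<close>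

section \<open>The optimal reflection level is negative\<close>

lemma has_bochner_integral_exp_tail:
  fixes u r :: real
  assumes "0 < u"
  shows "has_bochner_integral lborel (\<lambda>z. indicator {r..} z *\<^sub>R exp (- u * z)) (exp (- u * r) / u)"
proof (rule has_bochner_integral_nn_integral)
  show "(\<integral>\<^sup>+ z. ennreal (indicator {r..} z *\<^sub>R exp (- u * z)) \<partial>lborel) = ennreal (exp (- u * r) / u)"
    using nn_integral_has_integral_lebesgue[OF _ has_integral_exp_minus_to_infinity[OF assms, of r]]
    by simp
qed (use assms in auto)

lemma set_integrable_exp_tail:
  fixes u r :: real
  assumes "0 < u"
  shows "set_integrable lborel {r..} (\<lambda>z. exp (- u * z))"
  using has_bochner_integral_exp_tail[OF assms, of r]
  unfolding set_integrable_def has_bochner_integral_iff by simp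

lemma set_integral_exp_tail:
  fixes u r :: real
  assumes "0 < u"
  shows "(LBINT z:{r..}. exp (- u * z)) = exp (- u * r) / u"
  using has_bochner_integral_exp_tail[OF assms, of r]
  unfolding set_lebesgue_integral_def has_bochner_integral_iff by simp

text \<open>
  The growth rate \<open>b\<close> of the cost is below \<open>\<gamma>low / 2\<close>, hence below \<open>u\<close>, so far out the integrand is
  dominated by a decaying exponential of rate \<open>u - b\<close>.
\<close>

lemma set_integrable_cost_tail:
  fixes h :: "real \<Rightarrow> real"
  assumes h: "cost_assumption \<gamma>low h" and u: "\<gamma>low \<le> u"
  shows "set_integrable lborel {a..} (\<lambda>z. h z * exp (- u * z))"
proof -
  have cont: "continuous_on UNIV h" and nonneg: "\<And>x. 0 \<le> h x"
    using h by (auto simp: cost_assumption_def)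
  obtain b where b: "0 < b" "b < \<gamma>low / 2" "Limsup at_top (\<lambda>x. ereal (h x / exp (b * x))) < \<infinity>"
    using h by (auto simp: cost_assumption_def)
  have "b < u" using b u by linarith
  obtain K :: real where "Limsup at_top (\<lambda>x. ereal (h x / exp (b * x))) < ereal K"
    using b(3) less_PInf_Ex_of_nat by fastforce
  from Limsup_lessD[OF this] have "\<forall>\<^sub>F x in at_top. h x / exp (b * x) < K" by simp
  then obtain N0 where N0: "\<And>x. N0 \<le> x \<Longrightarrow> h x / exp (b * x) < K"
    by (auto simp: eventually_at_top_linorder)
  define N where "N = max a N0"
  have dom: "norm (h x * exp (- u * x)) \<le> norm (K * exp (- (u - b) * x))" if "x \<in> {N..}" for x
  proof -
    have "h x \<le> K * exp (b * x)"
      using N0[of x] that by (simp add: N_def field_simps)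
    then have "h x * exp (- u * x) \<le> K * exp (b * x) * exp (- u * x)"
      by (intro mult_right_mono) auto
    also have "\<dots> = K * exp (- (u - b) * x)"
      by (simp add: mult.assoc exp_add[symmetric] algebra_simps)
    finally show ?thesis using nonneg[of x] by auto
  qed
  have meas: "set_borel_measurable lborel A (\<lambda>z. h z * exp (- u * z))" if "A \<in> sets borel" for A
  proof -
    have "(\<lambda>z. h z * exp (- u * z)) \<in> borel_measurable borel"
      by (intro borel_measurable_continuous_onI continuous_intros cont)
    then show ?thesis using that by (simp add: set_borel_measurable_def)
  qed
  have "set_integrable lborel {N..} (\<lambda>z. h z * exp (- u * z))"
  proof (rule set_integrable_bound)
    show "set_integrable lborel {N..} (\<lambda>z. K * exp (- (u - b) * z))"
      by (rule set_integrable_mult_right, rule set_integrable_exp_tail) (use \<open>b < u\<close> in simp)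
  qed (use dom meas in auto)
  moreover have "set_integrable lborel {a..N} (\<lambda>z. h z * exp (- u * z))"
    by (intro borel_integrable_atLeastAtMost' continuous_intros continuous_on_subset[OF cont]) auto
  ultimately have "set_integrable lborel ({a..N} \<union> {N..}) (\<lambda>z. h z * exp (- u * z))"
    by (intro set_integrable_Un) auto
  also have "{a..N} \<union> {N..} = {a..}" by (auto simp: N_def)
  finally show ?thesis .
qed

text \<open>
  Removing the factor \<open>exp (u * r)\<close> from \<open>cost_F\<close> keeps its sign and leaves \<open>r\<close> only in places
  where its derivative is immediate.
\<close>

definition cost_D :: "(real \<Rightarrow> real) \<Rightarrow> real \<Rightarrow> real \<Rightarrow> real" where
  "cost_D h u r = u * (LBINT z:{r..}. h z * exp (- u * z)) - exp (- u * r) * h r"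

lemma cost_F_eq_cost_D: "cost_F h u r = exp (u * r) * cost_D h u r"
proof -
  have "(LBINT z:{r..}. h z * exp (- u * (z - r)))
      = (LBINT z:{r..}. exp (u * r) * (h z * exp (- u * z)))"
    by (rule arg_cong[where f = "set_lebesgue_integral lborel {r..}"])
       (auto simp: fun_eq_iff exp_add[symmetric] exp_diff exp_minus algebra_simps divide_inverse)
  also have "\<dots> = exp (u * r) * (LBINT z:{r..}. h z * exp (- u * z))"
    by simp
  finally show ?thesis
    by (simp add: cost_F_def cost_C_def cost_D_def exp_minus field_simps)
qed

text \<open>
  The discounted average of \<open>h\<close> over \<open>{r..}\<close> exceeds \<open>h r\<close>: strictness comes from bounding \<open>h\<close> below
  by the larger constant \<open>h (r + 1)\<close> from \<open>r + 1\<close> onwards.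
\<close>

lemma cost_D_pos:
  assumes h: "cost_assumption \<gamma>low h" and u: "\<gamma>low \<le> u" "0 < u" and r: "0 \<le> r"
  shows "0 < cost_D h u r"
proof -
  have sm: "strict_mono_on {0..} h"
    using h by (auto simp: cost_assumption_def)
  define d where "d = h (r + 1) - h r"
  have "0 < d"
    using strict_mono_onD[OF sm, of r "r + 1"] r by (simp add: d_def)
  have mono: "h y \<le> h z" if "0 \<le> y" "y \<le> z" for y z
    using strict_mono_on_imp_mono_on[OF sm] that by (auto simp: mono_on_def)
  let ?e = "\<lambda>z. exp (- u * z)"
  let ?g = "\<lambda>z. h r * (indicator {r..} z *\<^sub>R ?e z) + d * (indicator {r+1..} z *\<^sub>R ?e z)"
  have g: "has_bochner_integral lborel ?g (h r * (?e r / u) + d * (?e (r + 1) / u))"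
    by (intro has_bochner_integral_add has_bochner_integral_mult_right
        has_bochner_integral_exp_tail u(2))
  have "h r * (?e r / u) + d * (?e (r + 1) / u) \<le> (LBINT z:{r..}. h z * ?e z)"
    unfolding has_bochner_integral_integral_eq[OF g, symmetric] set_lebesgue_integral_def
  proof (rule integral_mono)
    show "integrable lborel ?g" using g by (rule integrable.intros)
    show "integrable lborel (\<lambda>z. indicator {r..} z *\<^sub>R (h z * ?e z))"
      using set_integrable_cost_tail[OF h u(1)] by (simp add: set_integrable_def)
    fix z
    have "h r * ?e z \<le> h z * ?e z" if "r \<le> z"
      using mono[of r z] that r by (intro mult_right_mono) auto
    moreover have "h r * ?e z + d * ?e z \<le> h z * ?e z" if "r + 1 \<le> z"
    proof -
      have "(h r + d) * ?e z \<le> h z * ?e z"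
        using mono[of "r + 1" z] that r by (intro mult_right_mono) (auto simp: d_def)
      then show ?thesis by (simp add: distrib_right)
    qed
    ultimately show "?g z \<le> indicator {r..} z *\<^sub>R (h z * ?e z)"
      by (auto simp: indicator_def)
  qed
  then have "u * (h r * (?e r / u) + d * (?e (r + 1) / u)) \<le> u * (LBINT z:{r..}. h z * ?e z)"
    using u(2) by (intro mult_left_mono) auto
  moreover have "u * (h r * (?e r / u) + d * (?e (r + 1) / u)) = ?e r * h r + d * ?e (r + 1)"
    using u(2) by (simp add: field_simps)
  moreover have "0 < d * ?e (r + 1)" using \<open>0 < d\<close> by simp
  ultimately show ?thesis unfolding cost_D_def by linarith
qed

text \<open>
  Only the integral over the bounded interval depends on \<open>r\<close>, so the fundamental theorem of calculus
  differentiates the tail.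
\<close>

lemma cost_tail_split:
  assumes h: "cost_assumption \<gamma>low h" and u: "\<gamma>low \<le> u" and r: "r \<le> 0"
  shows "(LBINT z:{r..}. h z * exp (- u * z))
       = integral {r..0} (\<lambda>z. h z * exp (- u * z)) + (LBINT z:{0..}. h z * exp (- u * z))"
proof -
  let ?g = "\<lambda>z. h z * exp (- u * z)"
  have int: "set_integrable lborel {r..} ?g" by (rule set_integrable_cost_tail[OF h u])
  have icc: "set_integrable lborel {r..0} ?g"
    by (rule set_integrable_subset[OF int]) auto
  have ioi: "set_integrable lborel {0<..} ?g"
    by (rule set_integrable_subset[OF int]) (use r in auto)
  have "{r..} = {r..0} \<union> {0<..}" using r by auto
  then have "(LBINT z:{r..}. ?g z) = (LBINT z:{r..0}. ?g z) + (LBINT z:{0<..}. ?g z)"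
    by (simp only: set_integral_Un[OF _ icc ioi] ivl_disj_int)
  also have "(LBINT z:{0<..}. ?g z) = (LBINT z:{0..}. ?g z)"
    unfolding set_lebesgue_integral_def
  proof (rule integral_cong_AE)
    show "(\<lambda>z. indicator {0<..} z *\<^sub>R ?g z) \<in> borel_measurable lborel"
      using ioi unfolding set_integrable_def by (rule borel_measurable_integrable)
    show "(\<lambda>z. indicator {0..} z *\<^sub>R ?g z) \<in> borel_measurable lborel"
      using set_integrable_cost_tail[OF h u, of 0] unfolding set_integrable_def
      by (rule borel_measurable_integrable)
    show "AE z in lborel. indicator {0<..} z *\<^sub>R ?g z = indicator {0..} z *\<^sub>R ?g z"
      using AE_lborel_singleton[of 0] by eventually_elim (auto simp: indicator_def)
  qed
  also have "(LBINT z:{r..0}. ?g z) = integral {r..0} ?g"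
    using set_borel_integral_eq_integral[OF icc] by simp
  finally show ?thesis .
qed

text \<open>
  The derivative contains neither \<open>u * h r\<close> nor the integral: differentiating the tail gives
  \<open>- u * h r * exp (- u * r)\<close>, which cancels against the derivative of the exponential in
  \<open>- exp (- u * r) * h r\<close>.
\<close>

lemma
  assumes h: "cost_assumption \<gamma>low h" and u: "\<gamma>low \<le> u"
  shows continuous_on_cost_D: "continuous_on {a..0} (cost_D h u)"
    and DERIV_cost_D: "r < 0 \<Longrightarrow> DERIV (cost_D h u) r :> - exp (- u * r) * deriv h r"
proof -
  have cont: "continuous_on UNIV h"
    using h by (auto simp: cost_assumption_def)
  let ?g = "\<lambda>z. h z * exp (- u * z)"
  let ?c = "LBINT z:{0..}. ?g z"
  let ?D = "\<lambda>r. u * (integral {r..0} ?g + ?c) - exp (- u * r) * h r"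
  have contg: "continuous_on {a..0} ?g" for a
    by (intro continuous_intros continuous_on_subset[OF cont]) auto
  have eq: "cost_D h u r = ?D r" if "r \<le> 0" for r
    unfolding cost_D_def cost_tail_split[OF h u that] ..
  have der: "((\<lambda>r. integral {r..0} ?g) has_real_derivative - ?g t) (at t within {a..0})"
    if "t \<in> {a..0}" for a t
    by (rule integral_has_real_derivative'[OF contg that])
  have "continuous_on {a..0} (\<lambda>r. integral {r..0} ?g)"
    by (rule DERIV_continuous_on) (use der in blast)
  then have "continuous_on {a..0} ?D"
    by (intro continuous_intros continuous_on_subset[OF cont]) auto
  then show "continuous_on {a..0} (cost_D h u)"
    by (rule continuous_on_eq) (use eq in auto)
  show "DERIV (cost_D h u) r :> - exp (- u * r) * deriv h r" if "r < 0"
  proof -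
    have dh: "DERIV h r :> deriv h r"
      using h that by (auto simp: cost_assumption_def DERIV_deriv_iff_real_differentiable)
    have "at r within {r - 1..0} = at r"
      by (rule at_within_interior) (use that in auto)
    then have di: "DERIV (\<lambda>r. integral {r..0} ?g) r :> - ?g r"
      using der[of r "r - 1"] that by auto
    have "DERIV ?D r :> - exp (- u * r) * deriv h r"
      by (rule derivative_eq_intros di dh refl)+ (simp add: algebra_simps)
    moreover have "\<forall>\<^sub>F x in nhds r. cost_D h u x = ?D x"
      by (rule eventually_mono[OF eventually_nhds_in_open[of "{..<0}" r]])
        (use that in \<open>auto simp only: lessThan_iff open_lessThan intro!: eq less_imp_le\<close>)
    ultimately show ?thesis
      by (subst DERIV_cong_ev[OF refl _ refl]) auto
  qed
qed

lemma cost_D_strict_mono: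
  assumes h: "cost_assumption \<gamma>low h" and u: "\<gamma>low \<le> u" and ab: "a < b" "b \<le> 0"
  shows "cost_D h u a < cost_D h u b"
proof (rule DERIV_pos_imp_increasing_open[OF ab(1)])
  fix z assume "a < z" "z < b"
  with ab have z: "z < 0" by simp
  moreover have "0 < - exp (- u * z) * deriv h z"
    using h z by (auto simp: cost_assumption_def mult_pos_neg)
  ultimately show "\<exists>y. DERIV (cost_D h u) z :> y \<and> 0 < y"
    using DERIV_cost_D[OF h u] by blast
next
  show "continuous_on {a..b} (cost_D h u)"
    by (rule continuous_on_subset[OF continuous_on_cost_D[OF h u, of a]]) (use ab in auto)
qed

text \<open>
  Left of \<open>-1\<close> the discount weight is at least \<open>exp u\<close>, so \<open>cost_D\<close> falls at least as
  fast as \<open>exp u * h\<close> rises.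
\<close>

lemma cost_D_eventually_neg:
  assumes h: "cost_assumption \<gamma>low h" and u: "\<gamma>low \<le> u" "0 < u"
  shows "\<exists>a<0. cost_D h u a < 0"
proof -
  let ?G = "\<lambda>r. cost_D h u r + exp u * h r"
  have "filterlim h at_top at_bot"
    using h by (auto simp: cost_assumption_def)
  then have "\<forall>\<^sub>F r in at_bot. ?G (-1) / exp u < h r"
    by (simp add: filterlim_at_top_dense)
  moreover have "\<forall>\<^sub>F r in at_bot. r \<le> (-1::real)" by (rule eventually_le_at_bot)
  ultimately have "\<forall>\<^sub>F r in at_bot. ?G (-1) / exp u < h r \<and> r \<le> -1"
    by (rule eventually_conj)
  then obtain a where a: "?G (-1) / exp u < h a" "a \<le> -1"
    by (metis (no_types, lifting) eventually_at_bot_linorder order_refl)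
  have "?G a \<le> ?G (-1)"
  proof (rule DERIV_nonneg_imp_nondecreasing[OF a(2)])
    fix z assume z: "a \<le> z" "z \<le> -1"
    then have z0: "z < 0" by simp
    have dh: "DERIV h z :> deriv h z" and neg: "deriv h z < 0"
      using h z0 by (auto simp: cost_assumption_def DERIV_deriv_iff_real_differentiable)
    have "DERIV ?G z :> - exp (- u * z) * deriv h z + exp u * deriv h z"
      by (intro DERIV_add DERIV_cost_D[OF h u(1) z0] DERIV_cmult dh)
    moreover have "u * 1 \<le> u * (- z)"
      using z u(2) by (intro mult_left_mono) auto
    then have "exp u \<le> exp (- u * z)" by simp
    then have "0 \<le> (exp u - exp (- u * z)) * deriv h z"
      using neg by (intro mult_nonpos_nonpos) auto
    then have "0 \<le> - exp (- u * z) * deriv h z + exp u * deriv h z"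
      by (simp add: algebra_simps)
    ultimately show "\<exists>y. DERIV ?G z :> y \<and> 0 \<le> y" by blast
  qed
  moreover have "?G (-1) < exp u * h a"
    using a(1) by (simp add: field_simps)
  ultimately have "cost_D h u a < 0" by simp
  with a(2) show ?thesis by (intro exI[of _ a]) auto
qed

lemma opt_level_neg:
  assumes h: "cost_assumption \<gamma>low h" and u: "\<gamma>low \<le> u" "0 < u"
  shows "opt_level h u < 0"
proof -
  have zero_iff: "cost_F h u r = 0 \<longleftrightarrow> cost_D h u r = 0" for r
    by (simp add: cost_F_eq_cost_D)
  have pos: "0 < cost_D h u r" if "0 \<le> r" for r
    by (rule cost_D_pos[OF h u that])
  obtain a where a: "a < 0" "cost_D h u a < 0"
    using cost_D_eventually_neg[OF h u] by blast
  obtain r where r: "a \<le> r" "r \<le> 0" "cost_D h u r = 0"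
    using IVT'[of "cost_D h u" a 0 0] a pos[of 0] continuous_on_cost_D[OF h u(1), of a] by auto
  have "r < 0" using pos[of r] r(3) by (cases "r < 0") auto
  have "opt_level h u = r"
    unfolding opt_level_def
  proof (rule the_equality)
    show "cost_F h u r = 0" using r zero_iff by simp
    fix r' assume "cost_F h u r' = 0"
    then have r': "cost_D h u r' = 0" using zero_iff by simp
    then have "r' < 0" using pos[of r'] by (cases "r' < 0") auto
    with r' r \<open>r < 0\<close> show "r' = r"
      using cost_D_strict_mono[OF h u(1), of r r'] cost_D_strict_mono[OF h u(1), of r' r]
      by (cases r r' rule: linorder_cases) auto
  qed
  with \<open>r < 0\<close> show ?thesis by simp
qed

section \<open>Comparison of reflected paths\<close>

text \<open>
  The hypothesis \<open>off\<close> says that the Lebesgue-Stieltjes measure of \<open>Y\<close> does not charge the times at which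
  \<open>Z\<close> is above the barrier, and the mass of \<open>{q<..t}\<close> is the increment \<open>Y t - Y q\<close>.
\<close>

lemma regulator_flat_off_barrier:
  fixes Y Z :: "real \<Rightarrow> real"
  assumes cont: "continuous_on {s..} Y" and mono: "mono_on {s..} Y"
    and off: "(\<integral>\<^sup>+u\<in>{s..t}. indicator {v. r < Z v} u \<partial>interval_measure (\<lambda>u. Y (max s u))) = 0"
    and q: "s \<le> q" "q \<le> t" and above: "\<And>v. q < v \<Longrightarrow> v \<le> t \<Longrightarrow> r < Z v"
  shows "Y t = Y q"
proof -
  let ?Y = "\<lambda>u. Y (max s u)"
  have "continuous_on UNIV ?Y"
    by (rule continuous_on_compose2[OF cont]) (auto intro!: continuous_intros)
  then have "continuous (at_right a) ?Y" for a
    by (meson UNIV_I continuous_on_eq_continuous_within continuous_within_subset subset_UNIV)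
  then have "ennreal (?Y t - ?Y q) = emeasure (interval_measure ?Y) {q<..t}"
    using q by (intro emeasure_interval_measure_Ioc[symmetric]) (auto intro!: mono_onD[OF mono])
  also have "emeasure (interval_measure ?Y) {q<..t}
      = (\<integral>\<^sup>+u. indicator {q<..t} u \<partial>interval_measure ?Y)"
    by simp
  also have "\<dots> \<le> (\<integral>\<^sup>+u\<in>{s..t}. indicator {v. r < Z v} u \<partial>interval_measure ?Y)"
    using q above by (intro nn_integral_mono) (auto simp: indicator_def)
  finally have "ennreal (Y t - Y q) = 0" using off q by (simp add: max_absorb2)
  moreover have "Y q \<le> Y t" using q by (intro mono_onD[OF mono]) auto
  ultimately show ?thesis by (simp add: ennreal_eq_0_iff)
qed

text \<open>
  If \<open>Z\<close> were above \<open>Z'\<close> at time \<open>t\<close>, then since their last meeting \<open>Z\<close> would have been above \<open>Z' \<ge> r\<close>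
  and hence received no push, while \<open>Z'\<close> moved with the same increments plus its own pushes.
\<close>

lemma reflection_comparison:
  fixes Z Y Z' Y' :: "real \<Rightarrow> real"
  assumes contZ: "continuous_on {s..} Z" and contZ': "continuous_on {s..} Z'"
    and contY: "continuous_on {s..} Y"
    and mono: "mono_on {s..} Y" and mono': "mono_on {s..} Y'"
    and same_increments: "\<And>v. s \<le> v \<Longrightarrow> Z v - Z s - (Y v - Y s) = Z' v - Z' s - (Y' v - Y' s)"
    and off: "(\<integral>\<^sup>+u\<in>{s..t}. indicator {v. r < Z v} u \<partial>interval_measure (\<lambda>u. Y (max s u))) = 0"
    and above: "\<And>v. s \<le> v \<Longrightarrow> r \<le> Z' v"
    and start: "Z s \<le> Z' s" and t: "s \<le> t"
  shows "Z t \<le> Z' t"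
proof -
  let ?A = "{v \<in> {s..t}. Z v \<le> Z' v}"
  have "closed ?A"
    by (intro continuous_on_closed_Collect_le continuous_on_subset[OF contZ]
        continuous_on_subset[OF contZ']) auto
  moreover have "?A \<subseteq> {s..t}" by auto
  ultimately have "compact ?A"
    by (meson bounded_closed_interval bounded_subset compact_eq_bounded_closed)
  moreover have "?A \<noteq> {}" using start t by auto
  ultimately obtain q where q: "q \<in> ?A" "\<And>v. v \<in> ?A \<Longrightarrow> v \<le> q"
    using compact_attains_sup[of ?A] by blast
  have "r < Z v" if "q < v" "v \<le> t" for v
  proof (rule ccontr)
    assume "\<not> r < Z v"
    then have "v \<in> ?A" using q(1) that above[of v] by simp
    with q(2)[of v] that show False by simp
  qed
  then have "Y t = Y q"
    using q(1) by (intro regulator_flat_off_barrier[OF contY mono off]) auto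
  moreover have "Y' q \<le> Y' t" using q(1) by (intro mono_onD[OF mono']) auto
  moreover have "Z q \<le> Z' q" using q(1) by simp
  ultimately show ?thesis
    using same_increments[of t] same_increments[of q] q(1) t by auto
qed

section \<open>The levels and states of the adaptive-update algorithm\<close>

lemma tau_strict_mono: "tau k < tau (Suc k)"
  by (simp add: tau_def)

lemma tau_nonneg: "0 \<le> tau k"
  by (simp add: tau_def)

lemma rhat_path_nonpos:
  assumes "\<And>k. rhat k \<omega> \<le> 0"
  shows "rhat_path rhat t \<omega> \<le> 0"
proof -
  let ?f = "\<lambda>k. rhat k \<omega> * indicator {tau k..<tau (Suc k)} t"
  \<comment> \<open>As \<open>k \<le> tau k\<close>, only finitely many cycles start by time \<open>t\<close>; so the series is a finite sum.\<close>
  have zero: "?f k = 0" if "k \<notin> {..nat \<lfloor>t\<rfloor>}" for k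
  proof -
    have "real k + 1 \<le> 2 ^ k"
      using less_exp[of k] by (metis Suc_leI add.commute of_nat_Suc of_nat_le_iff
          of_nat_numeral of_nat_power)
    moreover have "t < real k" using that by (simp add: nat_less_iff not_le) linarith
    ultimately have "t < tau k" by (simp add: tau_def)
    then show ?thesis by simp
  qed
  have "(\<Sum>k. ?f k) = (\<Sum>k\<le>nat \<lfloor>t\<rfloor>. ?f k)"
    by (rule suminf_finite) (use zero in auto)
  also have "\<dots> \<le> 0"
    using assms by (intro sum_nonpos mult_nonpos_nonneg) auto
  finally show ?thesis by (simp add: rhat_path_def)
qed

lemma AU_level_nonpos:
  assumes AU: "AU_algorithm M F B \<theta> \<sigma> h \<gamma>low x ZAU rhat \<gamma>hat X"
    and h: "cost_assumption \<gamma>low h" and "0 < \<gamma>low" and \<omega>: "\<omega> \<in> space M"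
  shows "rhat k \<omega> \<le> 0"
proof (cases k)
  case 0
  with AU \<omega> show ?thesis by (simp add: AU_algorithm_def)
next
  case (Suc n)
  have "rhat k \<omega> = opt_level h (\<gamma>hat k \<omega>)" and low: "\<gamma>low \<le> \<gamma>hat k \<omega>"
    using AU \<omega> unfolding AU_algorithm_def Suc by simp_all
  then show ?thesis
    using opt_level_neg[OF h low] \<open>0 < \<gamma>low\<close> by simp
qed

lemma Z_moving_le_reflected:
  assumes repr: "\<And>t. 0 \<le> t \<Longrightarrow> Z0 t \<omega> = x + \<theta> * t + \<sigma> * B t \<omega> + Y0 t \<omega> \<and> 0 \<le> Z0 t \<omega>"
    and mono: "mono_on {0..} (\<lambda>t. Y0 t \<omega>)" and start: "Y0 0 \<omega> = 0"
    and level: "\<And>k. rhat k \<omega> \<le> 0" and t: "0 \<le> t"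
  shows "Z_moving B \<theta> \<sigma> x rhat t \<omega> \<le> Z0 t \<omega>"
proof -
  have "Y_moving B \<theta> \<sigma> x rhat t \<omega> \<le> Y0 t \<omega>"
    unfolding Y_moving_def
  proof (rule cSUP_least)
    show "{0..t} \<noteq> {}" using t by simp
    fix s assume s: "s \<in> {0..t}"
    have "Y0 0 \<omega> \<le> Y0 s \<omega>" "Y0 s \<omega> \<le> Y0 t \<omega>"
      using s by (auto intro!: mono_onD[OF mono])
    moreover have "rhat_path rhat s \<omega> - x - \<theta> * s - \<sigma> * B s \<omega> \<le> Y0 s \<omega>"
      using repr[of s] rhat_path_nonpos[of rhat \<omega> s, OF level] s by simp
    ultimately show "max 0 (rhat_path rhat s \<omega> - x - \<theta> * s - \<sigma> * B s \<omega>) \<le> Y0 t \<omega>"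
      using start by simp
  qed
  then show ?thesis using repr[OF t] by (simp add: Z_moving_def)
qed

text \<open>
  One cycle: the comparison holds up to the end of the cycle, where continuity identifies the left
  limit of the algorithm's path with the value of the reflected path of the cycle.
\<close>

lemma AU_state_step:
  assumes AU: "AU_algorithm M F B \<theta> \<sigma> h \<gamma>low x ZAU rhat \<gamma>hat X"
    and Z0: "reflected_BM M F B \<theta> \<sigma> 0 (\<lambda>_. 0) (\<lambda>_. x) Z0 Y0"
    and level: "\<And>k \<omega>. \<omega> \<in> space M \<Longrightarrow> rhat k \<omega> \<le> 0"
    and IH: "AE \<omega> in M. X k \<omega> \<le> Z0 (tau k) \<omega>"
  shows "AE \<omega> in M. X (Suc k) \<omega> \<le> Z0 (tau (Suc k)) \<omega>"
proof -
  let ?s = "tau k" and ?t = "tau (Suc k)"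
  have st: "0 \<le> ?s" "?s < ?t" by (simp_all add: tau_nonneg tau_strict_mono)
  from AU obtain Z Y where R: "reflected_BM M F B \<theta> \<sigma> ?s (rhat k) (X k) Z Y"
    and ZAU: "\<And>\<omega> v. \<omega> \<in> space M \<Longrightarrow> v \<in> {?s..<?t} \<Longrightarrow> ZAU v \<omega> = Z v \<omega>"
    unfolding AU_algorithm_def by blast
  have X: "X (Suc k) \<omega> = max (Lim (at_left ?t) (\<lambda>v. ZAU v \<omega>)) (rhat (Suc k) \<omega>)"
    if "\<omega> \<in> space M" for \<omega>
    using AU that unfolding AU_algorithm_def by blast
  have path: "AE \<omega> in M.
      continuous_on {?s..} (\<lambda>t. Z t \<omega>) \<and> continuous_on {?s..} (\<lambda>t. Y t \<omega>) \<and>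
      (\<forall>t\<ge>?s. Z t \<omega> = X k \<omega> + \<theta> * (t - ?s) + \<sigma> * (B t \<omega> - B ?s \<omega>) + Y t \<omega> \<and> rhat k \<omega> \<le> Z t \<omega>) \<and>
      mono_on {?s..} (\<lambda>t. Y t \<omega>) \<and> Y ?s \<omega> = 0 \<and>
      (\<forall>t\<ge>?s. (\<integral>\<^sup>+u\<in>{?s..t}. indicator {v. rhat k \<omega> < Z v \<omega>} u
                  \<partial>interval_measure (\<lambda>u. Y (max ?s u) \<omega>)) = 0)"
    using R unfolding reflected_BM_def by blast
  have path0: "AE \<omega> in M.
      continuous_on {0..} (\<lambda>t. Z0 t \<omega>) \<and>
      (\<forall>t\<ge>0. Z0 t \<omega> = x + \<theta> * t + \<sigma> * (B t \<omega> - B 0 \<omega>) + Y0 t \<omega> \<and> 0 \<le> Z0 t \<omega>) \<and>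
      mono_on {0..} (\<lambda>t. Y0 t \<omega>)"
    using Z0 unfolding reflected_BM_def by simp
  show ?thesis
    using path path0 IH AE_space
  proof eventually_elim
    case (elim \<omega>)
    note P = elim(1) and P0 = elim(2) and start = elim(3) and \<omega> = elim(4)
    have contZ: "continuous_on {?s..} (\<lambda>t. Z t \<omega>)" using P by blast
    have Zeq: "Z v \<omega> = X k \<omega> + \<theta> * (v - ?s) + \<sigma> * (B v \<omega> - B ?s \<omega>) + Y v \<omega>" if "?s \<le> v" for v
      using P that by blast
    have Z0eq: "Z0 v \<omega> = x + \<theta> * v + \<sigma> * (B v \<omega> - B 0 \<omega>) + Y0 v \<omega>" "0 \<le> Z0 v \<omega>" if "0 \<le> v" for v
      using P0 that by blast+
    have le: "Z ?t \<omega> \<le> Z0 ?t \<omega>"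
    proof (rule reflection_comparison[where Z = "\<lambda>v. Z v \<omega>" and Z' = "\<lambda>v. Z0 v \<omega>"
          and Y = "\<lambda>v. Y v \<omega>" and Y' = "\<lambda>v. Y0 v \<omega>" and s = ?s and r = "rhat k \<omega>"])
      show "continuous_on {?s..} (\<lambda>v. Z v \<omega>)" by (rule contZ)
      show "continuous_on {?s..} (\<lambda>v. Z0 v \<omega>)"
        using P0 st by (auto intro: continuous_on_subset)
      show "continuous_on {?s..} (\<lambda>v. Y v \<omega>)" "mono_on {?s..} (\<lambda>v. Y v \<omega>)"
        using P by blast+
      show "mono_on {?s..} (\<lambda>v. Y0 v \<omega>)"
        using P0 st by (auto intro: mono_on_subset)
      show "(\<integral>\<^sup>+u\<in>{?s..?t}. indicator {v. rhat k \<omega> < Z v \<omega>} u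
                  \<partial>interval_measure (\<lambda>u. Y (max ?s u) \<omega>)) = 0"
        using P st by auto
      show "Z v \<omega> - Z ?s \<omega> - (Y v \<omega> - Y ?s \<omega>) = Z0 v \<omega> - Z0 ?s \<omega> - (Y0 v \<omega> - Y0 ?s \<omega>)"
        if "?s \<le> v" for v
        using Zeq[OF that] Zeq[of ?s] Z0eq(1)[of v] Z0eq(1)[of ?s] that st
        by (simp add: algebra_simps)
      show "rhat k \<omega> \<le> Z0 v \<omega>" if "?s \<le> v" for v
        using level[OF \<omega>, of k] Z0eq(2)[of v] that st by linarith
      show "Z ?s \<omega> \<le> Z0 ?s \<omega>" using Zeq[of ?s] P start by simp
      show "?s \<le> ?t" using st by simp
    qed
    have "((\<lambda>v. Z v \<omega>) \<longlongrightarrow> Z ?t \<omega>) (at ?t within {?s..})"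
      using contZ st by (simp add: continuous_on_def)
    then have "((\<lambda>v. Z v \<omega>) \<longlongrightarrow> Z ?t \<omega>) (at ?t within {?s..?t})"
      by (rule tendsto_within_subset) auto
    then have "((\<lambda>v. Z v \<omega>) \<longlongrightarrow> Z ?t \<omega>) (at_left ?t)"
      by (simp only: at_within_Icc_at_left[OF st(2)])
    moreover have "\<forall>\<^sub>F v in at_left ?t. Z v \<omega> = ZAU v \<omega>"
      using eventually_at_left_real[OF st(2)]
      by eventually_elim (use ZAU[OF \<omega>] in auto)
    ultimately have "((\<lambda>v. ZAU v \<omega>) \<longlongrightarrow> Z ?t \<omega>) (at_left ?t)"
      by (rule Lim_transform_eventually)
    then have "Lim (at_left ?t) (\<lambda>v. ZAU v \<omega>) = Z ?t \<omega>"
      by (intro tendsto_Lim) auto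
    moreover have "rhat (Suc k) \<omega> \<le> Z0 ?t \<omega>"
      using level[OF \<omega>, of "Suc k"] Z0eq(2)[OF tau_nonneg[of "Suc k"]] by linarith
    ultimately show ?case
      unfolding X[OF \<omega>] using le by (simp only: max.bounded_iff)
  qed
qed

theorem corollary1:
  fixes M :: "'a measure" and F :: "real \<Rightarrow> 'a measure" and B :: "real \<Rightarrow> 'a \<Rightarrow> real"
    and \<theta> \<sigma> \<gamma>low x :: real and h :: "real \<Rightarrow> real"
    and Z0 Y0 ZAU :: "real \<Rightarrow> 'a \<Rightarrow> real"
    and rhat \<gamma>hat X :: "nat \<Rightarrow> 'a \<Rightarrow> real"
  assumes "brownian_motion M F B"
    and "\<theta> < 0" and "0 < \<sigma>"
    and "0 < \<gamma>low" and "\<gamma>low \<le> - 2 * \<theta> / \<sigma>\<^sup>2"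
    and "cost_assumption \<gamma>low h"
    and "0 \<le> x"
    and "reflected_BM M F B \<theta> \<sigma> 0 (\<lambda>_. 0) (\<lambda>_. x) Z0 Y0"
    and "AU_algorithm M F B \<theta> \<sigma> h \<gamma>low x ZAU rhat \<gamma>hat X"
  shows "(AE \<omega> in M. \<forall>t\<ge>0. Z_moving B \<theta> \<sigma> x rhat t \<omega> \<le> Z0 t \<omega>) \<and>
         (\<forall>k\<ge>1. AE \<omega> in M. X k \<omega> \<le> Z0 (tau k) \<omega>)"
proof
  interpret brownian_motion M F B by fact
  have level: "rhat k \<omega> \<le> 0" if "\<omega> \<in> space M" for k \<omega>
    using AU_level_nonpos[OF assms(9,6,4) that] .
  have path0: "AE \<omega> in M.
      (\<forall>t\<ge>0. Z0 t \<omega> = x + \<theta> * t + \<sigma> * (B t \<omega> - B 0 \<omega>) + Y0 t \<omega> \<and> 0 \<le> Z0 t \<omega>) \<and>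
      mono_on {0..} (\<lambda>t. Y0 t \<omega>) \<and> Y0 0 \<omega> = 0"
    using assms(8) unfolding reflected_BM_def by simp
  show "AE \<omega> in M. \<forall>t\<ge>0. Z_moving B \<theta> \<sigma> x rhat t \<omega> \<le> Z0 t \<omega>"
    using path0 start_0 AE_space
  proof eventually_elim
    case (elim \<omega>)
    show ?case
    proof (intro allI impI)
      fix t :: real assume "0 \<le> t"
      show "Z_moving B \<theta> \<sigma> x rhat t \<omega> \<le> Z0 t \<omega>"
      proof (rule Z_moving_le_reflected[where ?Y0.0 = Y0])
        show "Z0 v \<omega> = x + \<theta> * v + \<sigma> * B v \<omega> + Y0 v \<omega> \<and> 0 \<le> Z0 v \<omega>" if "0 \<le> v" for v
          using elim(1,2) that by (metis diff_zero)
        show "mono_on {0..} (\<lambda>t. Y0 t \<omega>)" "Y0 0 \<omega> = 0"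
          using elim(1) by blast+
      qed (use level[OF elim(3)] \<open>0 \<le> t\<close> in blast)+
    qed
  qed
  have "AE \<omega> in M. X k \<omega> \<le> Z0 (tau k) \<omega>" for k
  proof (induction k)
    case 0
    have X0: "X 0 \<omega> = x" if "\<omega> \<in> space M" for \<omega>
      using assms(9) that by (simp add: AU_algorithm_def)
    show ?case
      using path0 AE_space by eventually_elim (simp add: tau_def X0)
  next
    case (Suc k)
    show ?case by (rule AU_state_step[OF assms(9,8) level Suc])
  qed
  then show "\<forall>k\<ge>1. AE \<omega> in M. X k \<omega> \<le> Z0 (tau k) \<omega>" by blast
qed

end
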